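(* Suppose the standing assumption on $E$, $x^*$, $x^{(0)}$ (with constants $\delta,M,\mu,L$) and the eigenvector accuracy condition $1\ge|{v_1^{(n)}}^\top\hat v_1^{(n)}|^2\ge 1-\alpha$ for all $n\ge 0$ hold, as stated in the context. Let $\kappa=L/\mu$ and suppose $\alpha$ satisfies $$0<\alpha<\frac12\quad\text{and}\quad 1-2\alpha>2\kappa(\alpha+2\sqrt{\alpha}).$$ Let $\eta=1-2\alpha-2\kappa(\alpha+2\sqrt\alpha)>0$ and $\hat r=\frac{2\mu\eta}{M}$, and suppose the initial point satisfies $$r_0=\|x^{(0)}-x^*\|_2<\min\{\delta,\hat r\},$$ and $\beta_n=\frac{2}{L+(1-2\alpha)\mu}$ for all $n\ge 0$. Then the iterates $$x^{(n+1)}=x^{(n)}-\beta_n\big(I-2\hat v_1^{(n)}{\hat v_1^{(n)}}^\top\big)\nabla E(x^{(n)})$$ converge to $x^*$ as $n\to\infty$, with $$r_n=\|x^{(n)}-x^*\|_2\le\left(1-\frac{2\eta}{\kappa+1-2\alpha+2\eta}\right)^n\frac{\hat r r_0}{\hat r-r_0}\qquad\text{for all } n\ge 0.$$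
   Context: $E:\mathbb{R}^d\to\mathbb{R}$ is a twice differentiable function and $x^*$ is a non-degenerate index-1 saddle point of $E$: $\nabla E(x^* )=0$ and the Hessian $\nabla^2E(x^* )$ has exactly one negative eigenvalue and no zero eigenvalue. $\|\cdot\|_2$ denotes the Euclidean norm on vectors and the induced operator norm on matrices. Standing assumption: there is $\delta>0$ such that, with $U(x^*,\delta)=\{x:\|x-x^*\|_2<\delta\}$, the initial point satisfies $x^{(0)}\in U(x^*,\delta)$ and: (i) there is a constant $M>0$ with $\|\nabla^2E(x)-\nabla^2E(y)\|_2\le M\|x-y\|_2$ for all $x,y\in U(x^*,\delta)$; (ii) there are constants $0<\mu<L$ such that for every $x\in U(x^*,\delta)$ the eigenvalues of $\nabla^2E(x)$ satisfy $\lambda_1<0<\lambda_2\le\cdots\le\lambda_d$ and $|\lambda_i|\in[\mu,L]$ for $1\le i\le d$. For each iterate $x^{(n)}$, $v_1^{(n)}$ is a unit eigenvector of $\nabla^2E(x^{(n)})$ for its smallest eigenvalue, and $\hat v_1^{(n)}\in\mathbb{R}^d$ is a unit vector (an approximation of $v_1^{(n)}$). Accuracy condition: $\alpha\in[0,1]$ is such that $1\ge|{v_1^{(n)}}^\top\hat v_1^{(n)}|^2\ge1-\alpha$ for every $n\ge0$. *)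

theory Defs
  imports "HOL-Analysis.Analysis" "HOL-Computational_Algebra.Computational_Algebra"
begin

definition grad :: "(real ^ 'n \<Rightarrow> real) \<Rightarrow> real ^ 'n \<Rightarrow> real ^ 'n" where
  "grad E x = (THE g. GDERIV E x :> g)"

definition twice_differentiable :: "(real ^ 'n \<Rightarrow> real) \<Rightarrow> bool" where
  "twice_differentiable E \<longleftrightarrow>
     (\<forall>x. E differentiable (at x)) \<and> (\<forall>x. grad E differentiable (at x))"

definition hessian :: "(real ^ 'n \<Rightarrow> real) \<Rightarrow> real ^ 'n \<Rightarrow> real ^ 'n ^ 'n" where
  "hessian E x = jacobian (grad E) (at x)"

definition charpoly :: "real ^ 'n ^ 'n \<Rightarrow> real poly" where
  "charpoly A = det (mat [:0, 1:] - map_matrix (\<lambda>c. [:c:]) A)"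

text \<open>The list of eigenvalues \<open>\<lambda>\<^sub>1 \<le> \<lambda>\<^sub>2 \<le> \<dots>\<close>, repeated according to (algebraic) multiplicity;
  the list position is the index minus one. Only real roots are collected, so the list has
  length \<open>CARD('n)\<close> exactly when all complex eigenvalues are real, as for symmetric matrices.\<close>

definition eigenvalues :: "real ^ 'n ^ 'n \<Rightarrow> real list" where
  "eigenvalues A = sorted_list_of_multiset (proots (charpoly A))"

definition index1_saddle :: "(real ^ 'n \<Rightarrow> real) \<Rightarrow> real ^ 'n \<Rightarrow> bool" where
  "index1_saddle E x \<longleftrightarrow>
     grad E x = 0 \<and>
     length (filter (\<lambda>l. l < 0) (eigenvalues (hessian E x))) = 1 \<and>
     0 \<notin> set (eigenvalues (hessian E x))"

definition unit_min_eigenvector :: "real ^ 'n ^ 'n \<Rightarrow> real ^ 'n \<Rightarrow> bool" where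
  "unit_min_eigenvector A v \<longleftrightarrow> norm v = 1 \<and> A *v v = (eigenvalues A ! 0) *\<^sub>R v"

definition op_norm :: "real ^ 'n ^ 'n \<Rightarrow> real" where
  "op_norm A = onorm (\<lambda>v. A *v v)"

definition outer :: "real ^ 'n \<Rightarrow> real ^ 'n \<Rightarrow> real ^ 'n ^ 'n" where
  "outer u v = (\<chi> i j. u $ i * v $ j)"

end

theory Submission
  imports Defs
begin

text \<open>Put \<open>d = x\<^sub>n - x\<^sup>*\<close>, \<open>r = \<parallel>d\<parallel>\<close> and \<open>H = \<nabla>\<^sup>2E(x\<^sub>n)\<close>. Since \<open>\<nabla>E(x\<^sup>*) = 0\<close> and the Hessian
  is \<open>M\<close>-Lipschitz, \<open>\<nabla>E(x\<^sub>n)\<close> equals \<open>H d\<close> up to \<open>M r\<^sup>2 / 2\<close> (\<open>linearization_error_le\<close>). If the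
  reflection used the exact eigenvector \<open>v\<close>, it would flip the single negative eigenvalue of \<open>H\<close>, and
  the step would be gradient descent for a symmetric map with spectrum in \<open>[\<mu>, L]\<close>: it contracts
  with factor \<open>\<rho> = max (1 - \<beta>\<mu>) (\<beta>L - 1)\<close> (\<open>exact_step_contracts\<close>; here \<open>\<rho> = \<beta>L - 1\<close>). Replacing
  \<open>v\<close> by a unit vector \<open>u\<close> with \<open>(v \<bullet> u)\<^sup>2 \<ge> 1 - \<alpha>\<close> changes the reflection by at most \<open>2 sqrt \<alpha>\<close> in norm
  (\<open>norm_reflect_diff_le\<close>), hence the step by at most \<open>2 \<beta> L r sqrt \<alpha>\<close>.

  Altogether \<open>r\<^sub>n\<^sub>+\<^sub>1 \<le> r\<^sub>n (\<rho> + 2 \<beta> L sqrt \<alpha> + \<beta> M r\<^sub>n / 2)\<close>. With \<open>a = \<beta>\<mu>\<eta> = 2\<eta> / (\<kappa> + 1 - 2\<alpha>)\<close>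
  the choice of \<open>\<eta>\<close> gives \<open>\<rho> + 2 \<beta> L sqrt \<alpha> \<le> 1 - a\<close>, and the choice of the radius \<open>R = 2\<mu>\<eta> / M\<close> gives
  \<open>\<beta> M / 2 = a / R\<close>, so that \<open>r\<^sub>n\<^sub>+\<^sub>1 \<le> r\<^sub>n (1 - a (1 - r\<^sub>n / R))\<close>. For such a recursion the quantity
  \<open>R r\<^sub>n / (R - r\<^sub>n)\<close> shrinks by the factor \<open>1 / (1 + a)\<close> in every step (\<open>damped_recursion_le\<close>), and
  \<open>1 / (1 + a)\<close> is the rate claimed.

  Two facts link the hypotheses, which speak of lists of roots of characteristic polynomials, with
  operator norms. The Hessian is self-adjoint (\<open>second_derivative_symmetric\<close>), so norms are
  controlled by eigenvectors (\<open>self_adjoint_norm_le\<close>). An eigenvector orthogonal to \<open>v\<close> has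
  its eigenvalue at a positive position of the list (\<open>orthogonal_eigenvalue_index\<close>), because two
  orthogonal eigenvectors for one eigenvalue make it a multiple root.\<close>

section \<open>Norms of self-adjoint maps\<close>

text \<open>Let \<open>w\<close> be a unit vector at which \<open>\<parallel>T w\<parallel>\<close> attains its maximum \<open>m\<close>. Expanding the square shows
  \<open>\<parallel>T\<^sup>2 w - m\<^sup>2 w\<parallel>\<^sup>2 \<le> 0\<close>, so \<open>(T - m) (T + m) w = 0\<close>: either \<open>w\<close> is an eigenvector for \<open>- m\<close>, or
  \<open>T w + m w\<close> is one for \<open>m\<close>. This yields the spectral bound without diagonalizing \<open>T\<close>.\<close>

lemma self_adjoint_norm_le:
  fixes T :: "'a::euclidean_space \<Rightarrow> 'a"
  assumes lin: "linear T"
    and sa: "\<And>x y. T x \<bullet> y = x \<bullet> T y"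
    and ev: "\<And>c w. w \<noteq> 0 \<Longrightarrow> T w = c *\<^sub>R w \<Longrightarrow> \<bar>c\<bar> \<le> R"
  shows "norm (T x) \<le> R * norm x"
proof -
  interpret linear T by (rule lin)
  have cont: "continuous_on (sphere 0 1) (\<lambda>x. norm (T x))"
    using lin by (intro continuous_on_norm linear_continuous_on linear_conv_bounded_linear[THEN iffD1])
  have "sphere (0::'a) 1 \<noteq> {}" by simp
  then obtain w where w: "norm w = 1" and max: "\<And>y. norm y = 1 \<Longrightarrow> norm (T y) \<le> norm (T w)"
    using continuous_attains_sup[OF compact_sphere _ cont] by auto
  define m where "m = norm (T w)"
  have bound: "norm (T y) \<le> m * norm y" for y
  proof (cases "y = 0")
    case False
    have "norm (T (inverse (norm y) *\<^sub>R y)) \<le> m"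
      unfolding m_def by (rule max) (use False in simp)
    then show ?thesis using False by (simp add: scaleR field_simps)
  qed (simp add: zero)
  have "norm (T (T w) - m\<^sup>2 *\<^sub>R w) ^ 2
      = norm (T (T w)) ^ 2 - 2 * m\<^sup>2 * (T (T w) \<bullet> w) + m ^ 4 * norm w ^ 2"
    unfolding power2_norm_eq_inner
    by (simp add: inner_diff_left inner_diff_right inner_commute algebra_simps
        power2_eq_square power4_eq_xxxx)
  also have "T (T w) \<bullet> w = m\<^sup>2"
    by (simp add: sa m_def power2_norm_eq_inner)
  also have "norm (T (T w)) ^ 2 \<le> (m * m) ^ 2"
    using bound[of "T w"] by (intro power_mono) (auto simp: m_def)
  finally have "norm (T (T w) - m\<^sup>2 *\<^sub>R w) ^ 2 \<le> 0"
    using w by (simp add: power2_eq_square power4_eq_xxxx)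
  then have sq: "T (T w) = m\<^sup>2 *\<^sub>R w" by simp
  have "m \<le> R"
  proof (cases "T w + m *\<^sub>R w = 0")
    case True
    then have "T w = (- m) *\<^sub>R w" by (simp add: eq_neg_iff_add_eq_0)
    from ev[OF _ this] w show ?thesis by force
  next
    case False
    have "T (T w + m *\<^sub>R w) = m *\<^sub>R (T w + m *\<^sub>R w)"
      by (simp add: add scaleR sq scaleR_add_right power2_eq_square)
    from ev[OF False this] show ?thesis by auto
  qed
  then show ?thesis
    using bound[of x] mult_right_mono[of m R "norm x"] by simp
qed

section \<open>Symmetry of the Hessian\<close>

lemma gderiv_unique:
  assumes "GDERIV f x :> a" "GDERIV f x :> b"
  shows "a = b"
proof -
  have "(\<lambda>h. h \<bullet> a) = (\<lambda>h. h \<bullet> b)"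
    using assms unfolding gderiv_def by (rule has_derivative_unique)
  then have "(a - b) \<bullet> a = (a - b) \<bullet> b" by meson
  then have "(a - b) \<bullet> (a - b) = 0" by (simp add: inner_diff_right)
  then show ?thesis by simp
qed

lemma gderiv_grad:
  fixes E :: "real ^ 'n \<Rightarrow> real"
  assumes "E differentiable (at x)"
  shows "GDERIV E x :> grad E x"
proof -
  obtain D where D: "(E has_derivative D) (at x)"
    using assms by (auto simp: differentiable_def)
  then have lin: "linear D" by (rule has_derivative_linear)
  have "D h = h \<bullet> adjoint D 1" for h
    using adjoint_works[OF lin, of h 1] by simp
  then have "GDERIV E x :> adjoint D 1"
    using D unfolding gderiv_def by (simp add: has_derivative_eq_rhs ext)
  then show ?thesis
    unfolding grad_def by (rule theI[where P = "\<lambda>g. GDERIV E x :> g"]) (rule gderiv_unique[OF _ \<open>GDERIV E x :> adjoint D 1\<close>])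
qed

text \<open>The mean value theorem in the direction \<open>u\<close> expresses the second difference of \<open>f\<close> by a
  difference of gradients, which the linearization of \<open>g\<close> at \<open>x\<close> reduces to \<open>s A v\<close> with an error
  of order \<open>e s\<close>.\<close>

lemma second_difference:
  fixes f :: "'a::real_inner \<Rightarrow> real" and g :: "'a \<Rightarrow> 'a"
  assumes f: "\<And>y. GDERIV f y :> g y"
    and A: "linear A"
    and approx: "\<And>h. norm h < d \<Longrightarrow> norm (g (x + h) - g x - A h) \<le> e * norm h"
    and s: "s > 0" "s * (norm u + norm v) < d" and e: "e \<ge> 0"
  shows "\<bar>(f (x + s *\<^sub>R u + s *\<^sub>R v) - f (x + s *\<^sub>R u) - f (x + s *\<^sub>R v) + f x) - s\<^sup>2 * (u \<bullet> A v)\<bar>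
           \<le> 2 * e * s\<^sup>2 * (norm u + norm v)\<^sup>2"
proof -
  interpret A: linear A by (rule A)
  define N where "N = norm u + norm v"
  define \<phi> where "\<phi> t = f (x + t *\<^sub>R u + s *\<^sub>R v) - f (x + t *\<^sub>R u)" for t
  have fd: "(f has_derivative (\<lambda>h. h \<bullet> g y)) (at y)" for y
    using f unfolding gderiv_def .
  have "(\<phi> has_real_derivative u \<bullet> (g (x + t *\<^sub>R u + s *\<^sub>R v) - g (x + t *\<^sub>R u))) (at t)" for t
    unfolding \<phi>_def has_field_derivative_def
    by (rule derivative_eq_intros has_derivative_compose[OF _ fd] refl)+
      (auto simp: inner_diff_right algebra_simps fun_eq_iff)
  then have "\<exists>z>0. z < s \<and> \<phi> s - \<phi> 0 = (s - 0) * (u \<bullet> (g (x + z *\<^sub>R u + s *\<^sub>R v) - g (x + z *\<^sub>R u)))"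
    by (intro MVT2) (use s in auto)
  then obtain z where z: "0 < z" "z < s"
    and mvt: "\<phi> s - \<phi> 0 = s * (u \<bullet> (g (x + z *\<^sub>R u + s *\<^sub>R v) - g (x + z *\<^sub>R u)))"
    by auto
  have n1: "norm (z *\<^sub>R u + s *\<^sub>R v) \<le> s * N"
  proof -
    have "norm (z *\<^sub>R u + s *\<^sub>R v) \<le> z * norm u + s * norm v"
      using norm_triangle_ineq[of "z *\<^sub>R u" "s *\<^sub>R v"] z s by simp
    also have "\<dots> \<le> s * N"
      using z by (simp add: N_def distrib_left mult_right_mono)
    finally show ?thesis .
  qed
  have n2: "norm (z *\<^sub>R u) \<le> s * N"
    using z s by (simp add: N_def mult_mono)
  define e1 where "e1 = g (x + (z *\<^sub>R u + s *\<^sub>R v)) - g x - A (z *\<^sub>R u + s *\<^sub>R v)"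
  define e2 where "e2 = g (x + z *\<^sub>R u) - g x - A (z *\<^sub>R u)"
  have sN: "s * N < d" using s by (simp add: N_def)
  have "norm e1 \<le> e * (s * N)" "norm e2 \<le> e * (s * N)"
    unfolding e1_def e2_def
    using approx[of "z *\<^sub>R u + s *\<^sub>R v"] approx[of "z *\<^sub>R u"] n1 n2 sN
      mult_left_mono[OF n1 e] mult_left_mono[OF n2 e] by linarith+
  then have e12: "norm (e1 - e2) \<le> 2 * e * s * N"
    using norm_triangle_ineq4[of e1 e2] by simp
  have "g (x + z *\<^sub>R u + s *\<^sub>R v) - g (x + z *\<^sub>R u) = s *\<^sub>R A v + (e1 - e2)"
    by (simp add: e1_def e2_def A.add A.scaleR algebra_simps)
  then have "\<phi> s - \<phi> 0 - s\<^sup>2 * (u \<bullet> A v) = s * (u \<bullet> (e1 - e2))"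
    unfolding mvt by (simp add: inner_add_right power2_eq_square distrib_left)
  then have "\<bar>\<phi> s - \<phi> 0 - s\<^sup>2 * (u \<bullet> A v)\<bar> = s * \<bar>u \<bullet> (e1 - e2)\<bar>"
    using s by (simp add: abs_mult)
  also have "\<dots> \<le> s * (norm u * norm (e1 - e2))"
    using s by (intro mult_left_mono Cauchy_Schwarz_ineq2) auto
  also have "\<dots> \<le> s * (N * (2 * e * s * N))"
    using s e12 by (intro mult_left_mono mult_mono) (auto simp: N_def)
  finally show ?thesis
    by (simp add: \<phi>_def N_def power2_eq_square algebra_simps)
qed

text \<open>The second difference does not change when \<open>u\<close> and \<open>v\<close> are swapped, whereas its leading terms
  are \<open>s\<^sup>2 (u \<bullet> A v)\<close> and \<open>s\<^sup>2 (v \<bullet> A u)\<close>.\<close>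

lemma second_derivative_symmetric:
  fixes f :: "'a::real_inner \<Rightarrow> real"
  assumes f: "\<And>y. GDERIV f y :> g y"
    and g: "(g has_derivative A) (at x)"
  shows "A u \<bullet> v = u \<bullet> A v"
proof -
  define N where "N = norm u + norm v"
  have A: "linear A" using g by (rule has_derivative_linear)
  have "\<bar>u \<bullet> A v - v \<bullet> A u\<bar> \<le> 0 + e" if "e > 0" for e
  proof -
    \<comment> \<open>The two error terms add up to at most \<open>4 e' s\<^sup>2 N\<^sup>2\<close>; the summand 1 covers the case \<open>N = 0\<close>.\<close>
    define e' where "e' = e / (4 * (N\<^sup>2 + 1))"
    have N1: "N\<^sup>2 + 1 > 0" by (simp add: add_nonneg_pos)
    have e': "e' > 0" using that N1 by (simp add: e'_def)
    obtain d where d: "d > 0"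
      and approx0: "\<And>y. norm (y - x) < d \<Longrightarrow> norm (g y - g x - A (y - x)) \<le> e' * norm (y - x)"
      using g e' unfolding has_derivative_at_alt by blast
    have approx: "norm (g (x + h) - g x - A h) \<le> e' * norm h" if "norm h < d" for h
      using approx0[of "x + h"] that by simp
    define s where "s = d / (2 * (N + 1))"
    have N0: "N \<ge> 0" by (simp add: N_def)
    have "d * N < d * (2 * (N + 1))" using d N0 by (intro mult_strict_left_mono) auto
    then have s: "s > 0" "s * N < d" using d N0 by (simp_all add: s_def divide_less_eq)
    have uv: "\<bar>(f (x + s *\<^sub>R u + s *\<^sub>R v) - f (x + s *\<^sub>R u) - f (x + s *\<^sub>R v) + f x)
        - s\<^sup>2 * (u \<bullet> A v)\<bar> \<le> 2 * e' * s\<^sup>2 * N\<^sup>2"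
      unfolding N_def using s e' by (intro second_difference[OF f A approx]) (auto simp: N_def)
    have vu: "\<bar>(f (x + s *\<^sub>R v + s *\<^sub>R u) - f (x + s *\<^sub>R v) - f (x + s *\<^sub>R u) + f x)
        - s\<^sup>2 * (v \<bullet> A u)\<bar> \<le> 2 * e' * s\<^sup>2 * (norm v + norm u)\<^sup>2"
      using s e' by (intro second_difference[OF f A approx]) (auto simp: N_def add.commute)
    have comm: "x + s *\<^sub>R v + s *\<^sub>R u = x + s *\<^sub>R u + s *\<^sub>R v" "norm v + norm u = N"
      by (simp_all add: N_def)
    have "\<bar>s\<^sup>2 * (u \<bullet> A v) - s\<^sup>2 * (v \<bullet> A u)\<bar> \<le> 4 * e' * s\<^sup>2 * N\<^sup>2"
      using uv vu unfolding comm by linarith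
    then have "s\<^sup>2 * \<bar>u \<bullet> A v - v \<bullet> A u\<bar> \<le> s\<^sup>2 * (4 * e' * N\<^sup>2)"
      unfolding right_diff_distrib[symmetric] abs_mult by (simp add: mult_ac)
    then have "\<bar>u \<bullet> A v - v \<bullet> A u\<bar> \<le> 4 * e' * N\<^sup>2"
      using s by simp
    also have "\<dots> \<le> e"
      using N1 that by (simp add: e'_def field_simps)
    finally show ?thesis by simp
  qed
  then have "\<bar>u \<bullet> A v - v \<bullet> A u\<bar> \<le> 0" by (rule field_le_epsilon)
  then show ?thesis by (simp add: inner_commute)
qed

lemma hessian_has_derivative:
  assumes "twice_differentiable E"
  shows "(grad E has_derivative (\<lambda>h. hessian E x *v h)) (at x)"
  using assms jacobian_works[of "grad E" "at x"]
  by (simp add: twice_differentiable_def hessian_def)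

lemma hessian_self_adjoint:
  assumes "twice_differentiable E"
  shows "(hessian E x *v y) \<bullet> z = y \<bullet> (hessian E x *v z)"
proof (rule second_derivative_symmetric[where f = E])
  show "GDERIV E y :> grad E y" for y
    using assms by (intro gderiv_grad) (simp add: twice_differentiable_def)
  show "(grad E has_derivative (\<lambda>h. hessian E x *v h)) (at x)"
    using assms by (rule hessian_has_derivative)
qed

section \<open>Eigenvalues as roots of the characteristic polynomial\<close>

lemma poly_det:
  fixes P :: "'a::comm_ring_1 poly ^ 'n ^ 'n"
  shows "poly (det P) t = det (map_matrix (\<lambda>p. poly p t) P)"
  by (simp add: det_def poly_sum poly_prod)

lemma poly_charpoly: "poly (charpoly A) t = det (mat t - A)"
  unfolding charpoly_def poly_det
  by (rule arg_cong[where f = det]) (simp add: vec_eq_iff mat_def)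

lemma det_eq_0_if_kernel:
  fixes A :: "real ^ 'n ^ 'n"
  assumes "A *v w = 0" "w \<noteq> 0"
  shows "det A = 0"
  using assms det_nz_iff_inj[of "\<lambda>x. A *v x"] 
  by (metis inj_eq matrix_of_matrix_vector_mul matrix_vector_mul_linear matrix_vector_mult_0_right)

lemma kernel_if_det_eq_0:
  fixes A :: "real ^ 'n ^ 'n"
  assumes "det A = 0"
  obtains w where "A *v w = 0" "w \<noteq> 0"
  using assms det_nz_iff_inj[of "\<lambda>x. A *v x"] linear_injective_0[of "\<lambda>x. A *v x"]
  by (metis matrix_of_matrix_vector_mul matrix_vector_mul_linear)

lemma mat_mult_vec: "mat t *v w = t *\<^sub>R (w :: real ^ 'n)"
proof -
  have "mat t = t *\<^sub>R (mat 1 :: real ^ 'n ^ 'n)" by (simp add: vec_eq_iff mat_def)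
  then show ?thesis by (simp add: scaleR_matrix_vector_assoc[symmetric])
qed

text \<open>A real number above the operator norm is not an eigenvalue.\<close>

lemma charpoly_nonzero: "charpoly A \<noteq> 0"
proof
  assume "charpoly A = 0"
  define t where "t = onorm (\<lambda>w. A *v w) + 1"
  have "det (mat t - A) = 0"
    using poly_charpoly[of A t] \<open>charpoly A = 0\<close> by simp
  then obtain w where "(mat t - A) *v w = 0" and w: "w \<noteq> 0"
    by (rule kernel_if_det_eq_0)
  then have "A *v w = t *\<^sub>R w" by (simp add: matrix_vector_mult_diff_rdistrib mat_mult_vec)
  moreover have bl: "bounded_linear (\<lambda>w. A *v w)" by simp
  moreover have "t > 0" using onorm_pos_le[OF bl] by (simp add: t_def)
  ultimately have "t * norm w \<le> onorm (\<lambda>w. A *v w) * norm w"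
    using onorm[OF bl, of w] by simp
  then show False using w by (simp add: t_def)
qed

lemma degree_charpoly_le:
  fixes A :: "real ^ 'n ^ 'n"
  shows "degree (charpoly A) \<le> CARD('n)"
  unfolding charpoly_def det_def
proof (rule degree_sum_le)
  fix p :: "'n \<Rightarrow> 'n"
  let ?P = "mat [:0, 1:] - map_matrix (\<lambda>c. [:c:]) A"
  have "degree (\<Prod>i\<in>UNIV. ?P $ i $ p i) \<le> (\<Sum>i\<in>UNIV. degree (?P $ i $ p i))"
    using degree_prod_sum_le[of UNIV "\<lambda>i. ?P $ i $ p i"] by (simp add: o_def)
  also have "\<dots> \<le> (\<Sum>i\<in>(UNIV::'n set). 1)"
    by (intro sum_mono) (auto simp: mat_def intro!: degree_diff_le)
  finally have "degree (\<Prod>i\<in>UNIV. ?P $ i $ p i) \<le> CARD('n)" by simp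
  then show "degree (of_int (sign p) * (\<Prod>i\<in>UNIV. ?P $ i $ p i)) \<le> CARD('n)"
    by (intro order.trans[OF degree_mult_le]) simp
qed simp

lemma mset_eigenvalues: "mset (eigenvalues A) = proots (charpoly A)"
  by (simp add: eigenvalues_def)

text \<open>Ensures that every entry of the list has an index below the dimension, the range in which
  bounds on the eigenvalues are available.\<close>

lemma length_eigenvalues_le:
  fixes A :: "real ^ 'n ^ 'n"
  shows "length (eigenvalues A) \<le> CARD('n)"
proof -
  have "length (eigenvalues A) = size (proots (charpoly A))"
    by (metis mset_eigenvalues size_mset)
  also have "\<dots> \<le> CARD('n)"
    using size_proots_le degree_charpoly_le by (rule order.trans)
  finally show ?thesis .
qed

lemma eigenvector_imp_eigenvalue:
  assumes "A *v w = c *\<^sub>R w" "w \<noteq> 0"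
  shows "c \<in> set (eigenvalues A)"
proof -
  have "det (mat c - A) = 0"
    using assms by (intro det_eq_0_if_kernel[of _ w])
      (simp_all add: matrix_vector_mult_diff_rdistrib mat_mult_vec)
  then have "poly (charpoly A) c = 0" by (simp add: poly_charpoly)
  then have "c \<in># proots (charpoly A)" using charpoly_nonzero[of A] by simp
  then show ?thesis by (metis mset_eigenvalues set_mset_mset)
qed

text \<open>Pulling the common factor out of each of the two rows by multilinearity.\<close>

lemma power2_dvd_det:
  fixes D :: "'a::comm_ring_1 ^ 'n ^ 'n"
  assumes "i \<noteq> j" "D $ i = c *s a" "D $ j = c *s b"
  shows "c\<^sup>2 dvd det D"
proof -
  have "D = (\<chi> k. if k = i then c *s a else D $ k)"
    using assms(2) by (auto simp: vec_eq_iff)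
  then have "det D = det (\<chi> k. if k = i then c *s a else D $ k)"
    by (rule arg_cong)
  also have "\<dots> = c * det (\<chi> k. if k = i then a else D $ k)"
    by (rule det_row_mul)
  also have "(\<chi> k. if k = i then a else D $ k)
      = (\<chi> k. if k = j then c *s b else if k = i then a else D $ k)"
    using assms(1,3) by (auto simp: vec_eq_iff)
  also have "det \<dots> = c * det (\<chi> k. if k = j then b else if k = i then a else D $ k)"
    by (rule det_row_mul)
  finally have "det D = c\<^sup>2 * det (\<chi> k. if k = j then b else if k = i then a else D $ k)"
    by (simp add: power2_eq_square mult.assoc)
  then show ?thesis by (rule dvdI)
qed

text \<open>Extend \<open>v\<close>, \<open>w\<close> to a basis and take a linear automorphism that maps the standard basis onto it.\<close>

lemma orthogonal_pair_columns:
  fixes v w :: "real ^ 'n"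
  assumes "v \<noteq> 0" "w \<noteq> 0" "v \<bullet> w = 0"
  obtains Q :: "real ^ 'n ^ 'n" and i j where
    "det Q \<noteq> 0" "i \<noteq> j" "column i Q = v" "column j Q = w"
proof -
  have "independent {v, w}"
    using assms by (intro pairwise_orthogonal_independent)
      (auto simp: pairwise_def orthogonal_def inner_commute)
  then obtain C where C: "{v, w} \<subseteq> C" "independent C" "UNIV \<subseteq> span C"
    using maximal_independent_subset_extend[of "{v, w}" UNIV] by auto
  have "card C = dim (UNIV :: (real ^ 'n) set)"
    using C by (intro basis_card_eq_dim) auto
  with C have "\<exists>f. linear f \<and> f ` Basis = C \<and> f ` (UNIV :: (real ^ 'n) set) = UNIV
                  \<and> inj_on f (UNIV :: (real ^ 'n) set)"
    by (intro basis_to_basis_subspace_isomorphism) (auto simp: independent_Basis dim_UNIV)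
  then obtain f :: "real ^ 'n \<Rightarrow> real ^ 'n" where f: "linear f" "f ` Basis = C" "inj f" by auto
  obtain i where i: "f (axis i 1) = v" using f(2) C(1) by (force simp: Basis_vec_def)
  obtain j where j: "f (axis j 1) = w" using f(2) C(1) by (force simp: Basis_vec_def)
  have "v \<noteq> w" using assms by auto
  then have "i \<noteq> j" using i j by auto
  moreover have "column i (matrix f) = v" "column j (matrix f) = w"
    using i j by (simp_all add: column_def matrix_def vec_eq_iff)
  moreover have "det (matrix f) \<noteq> 0" using f det_nz_iff_inj by blast
  ultimately show ?thesis using that by blast
qed

text \<open>Geometric multiplicity 2 forces algebraic multiplicity at least 2: multiply \<open>X - A\<close> by an
  invertible constant matrix \<open>Q\<close> that has \<open>v\<close> and \<open>w\<close> among its columns. Two columns of the product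
  are divisible by \<open>X - c\<close>, so its determinant is divisible by \<open>(X - c)\<^sup>2\<close>, while \<open>det Q\<close> is a
  nonzero constant.\<close>

lemma order_charpoly_ge_2:
  fixes A :: "real ^ 'n ^ 'n"
  assumes v: "A *v v = c *\<^sub>R v" "v \<noteq> 0"
    and w: "A *v w = c *\<^sub>R w" "w \<noteq> 0"
    and orth: "v \<bullet> w = 0"
  shows "order c (charpoly A) \<ge> 2"
proof -
  obtain Q i j where Q: "det Q \<noteq> 0" "i \<noteq> j" "column i Q = v" "column j Q = w"
    by (rule orthogonal_pair_columns[OF v(2) w(2) orth])
  define P where "P = mat [:0, 1:] - map_matrix (\<lambda>c. [:c:]) A"
  define Q' where "Q' = map_matrix (\<lambda>c. [:c:]) Q"
  \<comment> \<open>Transposed, because \<open>power2_dvd_det\<close> speaks of rows.\<close>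
  define D where "D = transpose (P ** Q')"
  have col: "D $ k = [:-c, 1:] *s (\<chi> m. [:u $ m:])"
    if k: "column k Q = u" and u: "A *v u = c *\<^sub>R u" for k u
  proof -
    have Qk: "Q $ l $ k = u $ l" for l using k by (auto simp: column_def)
    have Au: "(\<Sum>l\<in>UNIV. A $ m $ l * u $ l) = c * u $ m" for m
      using arg_cong[OF u, of "\<lambda>z. z $ m"] by (simp add: matrix_vector_mult_def)
    have "D $ k $ m = [:-c, 1:] * [:u $ m:]" for m
    proof -
      have summand: "P $ m $ l * Q' $ l $ k
          = (if m = l then [:0, u $ l:] else 0) - [:A $ m $ l * u $ l:]" for l
        by (simp add: P_def Q'_def Qk mat_def)
      have "D $ k $ m = (\<Sum>l\<in>UNIV. P $ m $ l * Q' $ l $ k)"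
        by (simp add: D_def transpose_def matrix_matrix_mult_def)
      also have "\<dots> = [:0, u $ m:] - (\<Sum>l\<in>UNIV. [:A $ m $ l * u $ l:])"
        unfolding summand sum_subtractf by simp
      also have "(\<Sum>l\<in>UNIV. [:A $ m $ l * u $ l:]) = [:c * u $ m:]"
        unfolding sum_to_poly Au ..
      finally show ?thesis by simp
    qed
    then show ?thesis by (simp add: vec_eq_iff)
  qed
  have "[:-c, 1:]\<^sup>2 dvd det D"
    using power2_dvd_det[OF Q(2) col[OF Q(3) v(1)] col[OF Q(4) w(1)]] .
  also have "det D = charpoly A * det Q'"
    by (simp add: D_def det_mul P_def charpoly_def)
  finally have dvd: "[:-c, 1:]\<^sup>2 dvd charpoly A * det Q'" .
  have "poly (det Q') c = det Q"
    unfolding poly_det Q'_def by (rule arg_cong[where f = det]) (simp add: vec_eq_iff)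
  then have Q'c: "poly (det Q') c \<noteq> 0" using Q(1) by simp
  then have nz: "charpoly A * det Q' \<noteq> 0" using charpoly_nonzero[of A] by auto
  have "2 \<le> order c (charpoly A * det Q')"
    using dvd nz by (simp add: order_divides)
  also have "\<dots> = order c (charpoly A)"
    using Q'c order_mult[OF nz, of c] order_0I[of "det Q'" c] by simp
  finally show ?thesis .
qed

text \<open>If \<open>c\<close> differs from the first entry, it sits further down in the list anyway; if it equals the
  first entry, it is a multiple root and is listed again.\<close>

lemma orthogonal_eigenvalue_index:
  fixes A :: "real ^ 'n ^ 'n"
  assumes v: "A *v v = (eigenvalues A ! 0) *\<^sub>R v" "v \<noteq> 0"
    and w: "A *v w = c *\<^sub>R w" "w \<noteq> 0"
    and orth: "v \<bullet> w = 0"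
  shows "\<exists>i. 1 \<le> i \<and> i < CARD('n) \<and> eigenvalues A ! i = c"
proof -
  have "c \<in> set (eigenvalues A)" using w by (rule eigenvector_imp_eigenvalue)
  then obtain a l where al: "eigenvalues A = a # l" by (cases "eigenvalues A") auto
  have "c \<in> set l"
  proof (cases "c = a")
    case True
    then have "2 \<le> order c (charpoly A)"
      using order_charpoly_ge_2[of A v c w] v w orth al by simp
    also have "\<dots> = count (mset (eigenvalues A)) c"
      using charpoly_nonzero[of A] by (simp add: mset_eigenvalues)
    finally have "c \<in># mset l" using True al by (simp add: count_greater_zero_iff[symmetric] del: count_greater_zero_iff set_mset_mset)
    then show ?thesis by simp
  next
    case False
    then show ?thesis using \<open>c \<in> set (eigenvalues A)\<close> al by simp
  qed
  then obtain k where "k < length l" "l ! k = c" by (auto simp: in_set_conv_nth)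
  then show ?thesis
    using length_eigenvalues_le[of A] al by (intro exI[of _ "Suc k"]) auto
qed

section \<open>The Taylor remainder\<close>

text \<open>The function \<open>t \<mapsto> g (a + t d) - t g'(a + d) d\<close> has a derivative of norm at most
  \<open>M (1 - t) \<parallel>d\<parallel>\<^sup>2\<close>, and the integral of \<open>1 - t\<close> over the unit interval is the factor \<open>1/2\<close>. The
  linearization is taken at the end point \<open>a + d\<close>, since the iteration knows the Hessian at the
  current iterate and not at the saddle.\<close>

lemma linearization_error_le:
  fixes g :: "'a::real_normed_vector \<Rightarrow> 'b::real_normed_vector"
  assumes g: "\<And>y. (g has_derivative g' y) (at y)"
    and lip: "\<And>t. 0 < t \<Longrightarrow> t < 1 \<Longrightarrow>
      norm (g' (a + t *\<^sub>R d) d - g' (a + d) d) \<le> M * (1 - t) * (norm d)\<^sup>2"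
  shows "norm (g (a + d) - g a - g' (a + d) d) \<le> M / 2 * (norm d)\<^sup>2"
proof -
  define \<phi> where "\<phi> t = g (a + t *\<^sub>R d) - t *\<^sub>R g' (a + d) d" for t
  define \<psi> where "\<psi> t = M * (norm d)\<^sup>2 * (t - t\<^sup>2 / 2)" for t
  have \<phi>': "(\<phi> has_vector_derivative (g' (a + t *\<^sub>R d) d - g' (a + d) d)) (at t)" for t
  proof -
    have "linear (g' (a + t *\<^sub>R d))" using g by (rule has_derivative_linear)
    then have lin: "g' (a + t *\<^sub>R d) (h *\<^sub>R d) = h *\<^sub>R g' (a + t *\<^sub>R d) d" for h
      by (rule linear_scale)
    show ?thesis
      unfolding \<phi>_def has_vector_derivative_def
      by (rule derivative_eq_intros has_derivative_compose[OF _ g] refl)+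
        (simp add: lin scaleR_diff_right fun_eq_iff)
  qed
  have \<psi>': "(\<psi> has_vector_derivative M * (1 - t) * (norm d)\<^sup>2) (at t)" for t
    unfolding \<psi>_def has_real_derivative_iff_has_vector_derivative[symmetric]
    by (auto intro!: derivative_eq_intros simp: algebra_simps)
  have cont: "continuous_on {0..1} \<phi>" "continuous_on {0..1} \<psi>"
    using \<phi>' \<psi>' by (auto intro!: continuous_at_imp_continuous_on has_vector_derivative_continuous)
  have "norm (\<phi> 1 - \<phi> 0) \<le> \<psi> 1 - \<psi> 0"
    by (rule differentiable_bound_general[OF zero_less_one cont \<phi>' \<psi>' lip])
  then show ?thesis by (simp add: \<phi>_def \<psi>_def algebra_simps)
qed

lemma norm_mult_vec_le_op_norm: "norm (A *v d) \<le> op_norm A * norm d"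
  unfolding op_norm_def by (rule onorm) simp

section \<open>Reflections\<close>

text \<open>For a unit vector \<open>u\<close> this is the reflection in the hyperplane orthogonal to \<open>u\<close>; it
  agrees with the action of the matrix \<open>I - 2 u u\<^sup>T\<close> (\<open>outer_reflection\<close>), but is available on every
  inner product space.\<close>

definition reflect :: "'a::real_inner \<Rightarrow> 'a \<Rightarrow> 'a" where
  "reflect u y = y - (2 * (u \<bullet> y)) *\<^sub>R u"

lemma outer_reflection: "(mat 1 - 2 *\<^sub>R outer u u) *v y = reflect u y"
proof -
  have "outer u u *v y = (u \<bullet> y) *\<^sub>R u"
    by (simp add: vec_eq_iff outer_def matrix_vector_mult_def inner_vec_def sum_distrib_left mult_ac)
  then show ?thesis
    by (simp add: reflect_def matrix_vector_mult_diff_rdistrib scaleR_matrix_vector_assoc[symmetric])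
qed

lemma reflect_add: "reflect u (y + z) = reflect u y + reflect u z"
  by (simp add: reflect_def algebra_simps inner_add_right)

lemma reflect_scaleR: "reflect u (c *\<^sub>R y) = c *\<^sub>R reflect u y"
  by (simp add: reflect_def algebra_simps)

lemma norm_reflect:
  assumes "norm u = 1"
  shows "norm (reflect u y) = norm y"
proof -
  have "u \<bullet> u = 1" using assms by (simp add: norm_eq_1)
  then have "reflect u y \<bullet> reflect u y = y \<bullet> y"
    by (simp add: reflect_def inner_diff_left inner_diff_right inner_commute algebra_simps)
  then show ?thesis by (simp add: norm_eq_sqrt_inner)
qed

text \<open>With \<open>c = v \<bullet> u\<close>, the claim is equivalent to the Cauchy-Schwarz inequality for the components
  of \<open>u\<close> and \<open>y\<close> orthogonal to \<open>v\<close>, whose squared norms are \<open>1 - c\<^sup>2\<close> and \<open>\<parallel>y\<parallel>\<^sup>2 - (v \<bullet> y)\<^sup>2\<close>. The factor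
  is twice the sine of the angle between the lines spanned by \<open>u\<close> and \<open>v\<close>.\<close>

lemma norm_reflect_diff_le:
  assumes u: "norm u = 1" and v: "norm v = 1"
  shows "norm (reflect u y - reflect v y) \<le> 2 * sqrt (1 - (v \<bullet> u)\<^sup>2) * norm y"
proof -
  define c a b where "c = v \<bullet> u" and "a = v \<bullet> y" and "b = u \<bullet> y"
  have uu: "u \<bullet> u = 1" and vv: "v \<bullet> v = 1" using u v by (simp_all add: norm_eq_1)
  have uv: "u \<bullet> v = c" "v \<bullet> u = c" "v \<bullet> y = a" "y \<bullet> v = a" "u \<bullet> y = b" "y \<bullet> u = b"
    by (simp_all add: c_def a_def b_def inner_commute)
  have c1: "c\<^sup>2 \<le> 1"
    using Cauchy_Schwarz_ineq2[of v u] u v by (simp add: c_def abs_square_le_1)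
  have "((u - c *\<^sub>R v) \<bullet> (y - a *\<^sub>R v))\<^sup>2
      \<le> ((u - c *\<^sub>R v) \<bullet> (u - c *\<^sub>R v)) * ((y - a *\<^sub>R v) \<bullet> (y - a *\<^sub>R v))"
    by (rule Cauchy_Schwarz_ineq)
  then have cs: "(b - c * a)\<^sup>2 \<le> (1 - c\<^sup>2) * (y \<bullet> y - a\<^sup>2)"
    by (simp add: inner_diff_left inner_diff_right uu vv uv power2_eq_square algebra_simps)
  have "(norm (reflect u y - reflect v y))\<^sup>2 = 4 * (a\<^sup>2 + b\<^sup>2 - 2 * c * a * b)"
    unfolding power2_norm_eq_inner reflect_def
    by (simp add: inner_diff_left inner_diff_right uu vv uv power2_eq_square algebra_simps)
  also have "\<dots> \<le> 4 * ((1 - c\<^sup>2) * (y \<bullet> y))"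
    using cs by (simp add: power2_eq_square algebra_simps)
  also have "\<dots> = (2 * sqrt (1 - c\<^sup>2) * norm y)\<^sup>2"
    using c1 by (simp add: power_mult_distrib power2_norm_eq_inner)
  finally have "(norm (reflect u y - reflect v y))\<^sup>2 \<le> (2 * sqrt (1 - c\<^sup>2) * norm y)\<^sup>2" .
  moreover have "0 \<le> 2 * sqrt (1 - c\<^sup>2) * norm y" using c1 by simp
  ultimately show ?thesis unfolding c_def by (rule power2_le_imp_le)
qed

section \<open>One step of the iteration\<close>

text \<open>Because \<open>v\<close> is an eigenvector of \<open>A\<close>, the reflection commutes with \<open>A\<close> and the step is a
  self-adjoint map. An eigenvector of the step that is orthogonal to \<open>v\<close> is an eigenvector of \<open>A\<close>;
  any other one has the same eigenvalue \<open>1 + \<beta> l\<close> as \<open>v\<close>. So every eigenvalue of the step is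
  \<open>1 - \<beta> t\<close> with \<open>t\<close> in \<open>[\<mu>, L]\<close>.\<close>

lemma exact_step_contracts:
  fixes A :: "'a::euclidean_space \<Rightarrow> 'a"
  assumes lin: "linear A" and sa: "\<And>x y. A x \<bullet> y = x \<bullet> A y"
    and v: "norm v = 1" "A v = l *\<^sub>R v" "- L \<le> l" "l \<le> - \<mu>"
    and perp: "\<And>c w. w \<noteq> 0 \<Longrightarrow> v \<bullet> w = 0 \<Longrightarrow> A w = c *\<^sub>R w \<Longrightarrow> \<mu> \<le> c \<and> c \<le> L"
    and \<beta>: "0 < \<beta>" and \<rho>: "1 - \<beta> * \<mu> \<le> \<rho>" "\<beta> * L - 1 \<le> \<rho>"
  shows "norm (d - \<beta> *\<^sub>R reflect v (A d)) \<le> \<rho> * norm d"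
proof -
  interpret A: linear A by (rule lin)
  have vA: "v \<bullet> A y = l * (v \<bullet> y)" for y
    using sa[of v y] v by simp
  have vv: "v \<bullet> v = 1" using v by (simp add: norm_eq_1)
  have spectral: "\<bar>1 - \<beta> * t\<bar> \<le> \<rho>" if "\<mu> \<le> t" "t \<le> L" for t
    using mult_left_mono[OF that(1), of \<beta>] mult_left_mono[OF that(2), of \<beta>] \<beta> \<rho> by linarith
  show ?thesis
  proof (rule self_adjoint_norm_le[where T = "\<lambda>d. d - \<beta> *\<^sub>R reflect v (A d)"])
    show "linear (\<lambda>d. d - \<beta> *\<^sub>R reflect v (A d))"
      by (rule linearI) (simp_all add: A.add A.scaleR reflect_add reflect_scaleR algebra_simps)
  next
    fix x y
    show "(x - \<beta> *\<^sub>R reflect v (A x)) \<bullet> y = x \<bullet> (y - \<beta> *\<^sub>R reflect v (A y))"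
      using sa[of x y] by (simp add: reflect_def vA inner_diff_left inner_diff_right inner_commute[of x v])
  next
    fix c w assume w: "w \<noteq> 0" and ev: "w - \<beta> *\<^sub>R reflect v (A w) = c *\<^sub>R w"
    show "\<bar>c\<bar> \<le> \<rho>"
    proof (cases "v \<bullet> w = 0")
      case True
      then have "w - \<beta> *\<^sub>R A w = c *\<^sub>R w" using ev by (simp add: reflect_def vA)
      then have "\<beta> *\<^sub>R A w = (1 - c) *\<^sub>R w" by (simp add: algebra_simps)
      then have "inverse \<beta> *\<^sub>R \<beta> *\<^sub>R A w = inverse \<beta> *\<^sub>R (1 - c) *\<^sub>R w" by simp
      then have "A w = (inverse \<beta> * (1 - c)) *\<^sub>R w" using \<beta> by simp
      from spectral[of "inverse \<beta> * (1 - c)"] perp[OF w True this] \<beta>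
      show ?thesis by (simp add: mult.assoc[symmetric])
    next
      case False
      have "v \<bullet> (w - \<beta> *\<^sub>R reflect v (A w)) = (1 - \<beta> * (- l)) * (v \<bullet> w)"
        by (simp add: reflect_def vA inner_diff_right vv algebra_simps)
      then have "c = 1 - \<beta> * (- l)" using False unfolding ev by simp
      then show ?thesis using spectral[of "- l"] v by simp
    qed
  qed
qed

text \<open>Split the step into the exact step, the change of the reflection, and the reflected
  linearization error; a reflection preserves the norm of the last.\<close>

lemma inexact_step_le:
  fixes A :: "'a::euclidean_space \<Rightarrow> 'a"
  assumes u: "norm u = 1" and v: "norm v = 1" and acc: "(v \<bullet> u)\<^sup>2 \<ge> 1 - \<alpha>"
    and exact: "norm (d - \<beta> *\<^sub>R reflect v (A d)) \<le> \<rho> * norm d"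
    and bound: "norm (A d) \<le> L * norm d"
    and err: "norm (g - A d) \<le> K" and \<beta>: "0 < \<beta>"
  shows "norm (d - \<beta> *\<^sub>R reflect u g) \<le> (\<rho> + 2 * \<beta> * L * sqrt \<alpha>) * norm d + \<beta> * K"
proof -
  have split: "d - \<beta> *\<^sub>R reflect u g = (d - \<beta> *\<^sub>R reflect v (A d))
      - \<beta> *\<^sub>R (reflect u (A d) - reflect v (A d)) - \<beta> *\<^sub>R reflect u (g - A d)"
    using reflect_add[of u "A d" "g - A d"] by (simp add: algebra_simps)
  have "norm (reflect u (A d) - reflect v (A d)) \<le> 2 * sqrt (1 - (v \<bullet> u)\<^sup>2) * norm (A d)"
    using u v by (rule norm_reflect_diff_le)
  also have "\<dots> \<le> 2 * sqrt \<alpha> * (L * norm d)"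
  proof -
    have "(v \<bullet> u)\<^sup>2 \<le> 1"
      using Cauchy_Schwarz_ineq2[of v u] u v by (simp add: abs_square_le_1)
    then show ?thesis
      using acc bound by (intro mult_mono real_sqrt_le_mono) auto
  qed
  finally have "\<beta> * norm (reflect u (A d) - reflect v (A d)) \<le> \<beta> * (2 * sqrt \<alpha> * (L * norm d))"
    using \<beta> by simp
  moreover have "\<beta> * norm (reflect u (g - A d)) \<le> \<beta> * K"
    using err \<beta> by (simp add: norm_reflect[OF u])
  moreover have "norm (d - \<beta> *\<^sub>R reflect u g) \<le> norm (d - \<beta> *\<^sub>R reflect v (A d))
      + \<beta> * norm (reflect u (A d) - reflect v (A d)) + \<beta> * norm (reflect u (g - A d))"
    unfolding split using \<beta>
    by (intro order.trans[OF norm_triangle_ineq4] add_mono order_refl) simp_all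
  ultimately show ?thesis using exact by (simp add: algebra_simps)
qed

section \<open>The scalar recursion\<close>

text \<open>In terms of \<open>z = a (R - r\<^sub>n)\<close> the hypothesis reads \<open>R r\<^sub>n\<^sub>+\<^sub>1 \<le> r\<^sub>n (R - z)\<close>. Multiplying by \<open>R + z\<close> and
  dropping \<open>z\<^sup>2\<close> from \<open>R\<^sup>2 - z\<^sup>2\<close> gives \<open>r\<^sub>n\<^sub>+\<^sub>1 (R + z) \<le> R r\<^sub>n\<close>, which is a rearrangement of
  \<open>(1 + a) R r\<^sub>n\<^sub>+\<^sub>1 / (R - r\<^sub>n\<^sub>+\<^sub>1) \<le> R r\<^sub>n / (R - r\<^sub>n)\<close>. The step is only assumed while \<open>r\<^sub>n \<le> r\<^sub>0\<close>, as
  that keeps the iterates in the ball where the Hessian is controlled.\<close>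

lemma damped_recursion_le:
  fixes r :: "nat \<Rightarrow> real"
  assumes nonneg: "\<And>n. 0 \<le> r n" and r0: "r 0 < R" and a: "a > 0"
    and step: "\<And>n. r n \<le> r 0 \<Longrightarrow> r (Suc n) \<le> r n * (1 - a + a * r n / R)"
  shows "r n \<le> r 0 \<and> r n \<le> (1 / (1 + a)) ^ n * (R * r 0 / (R - r 0))"
proof -
  have R: "R > 0" using nonneg[of 0] r0 by simp
  have "r n \<le> r 0 \<and> R * r n / (R - r n) \<le> (1 / (1 + a)) ^ n * (R * r 0 / (R - r 0))"
  proof (induction n)
    case (Suc n)
    define y z where "y = r n" and "z = a * (R - y)"
    have y: "0 \<le> y" "y < R" using Suc nonneg r0 by (auto simp: y_def)
    have z: "0 \<le> z" using y a by (simp add: z_def)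
    have "1 - a + a * y / R = (R - z) / R"
      using R by (simp add: z_def field_simps)
    then have s: "r (Suc n) \<le> y * (R - z) / R"
      using step[of n] Suc by (simp add: y_def)
    also have "\<dots> \<le> y"
      using R y z by (simp add: divide_le_eq mult_left_mono)
    finally have le: "r (Suc n) \<le> y" .
    have "r (Suc n) * (R + z) \<le> y * (R - z) / R * (R + z)"
      using s R z by (intro mult_right_mono) auto
    also have "\<dots> = y * (R\<^sup>2 - z\<^sup>2) / R"
      by (simp add: power2_eq_square algebra_simps)
    also have "\<dots> \<le> y * R\<^sup>2 / R"
      using R y by (intro divide_right_mono mult_left_mono) auto
    also have "\<dots> = y * R" using R by (simp add: power2_eq_square)
    finally have "(1 + a) * (r (Suc n) * (R - y)) \<le> y * (R - r (Suc n))"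
      by (simp add: z_def algebra_simps)
    then have "R * r (Suc n) / (R - r (Suc n)) \<le> (1 / (1 + a)) * (R * y / (R - y))"
      using R y le a by (simp add: divide_simps mult_ac)
    also have "\<dots> \<le> (1 / (1 + a)) * ((1 / (1 + a)) ^ n * (R * r 0 / (R - r 0)))"
      using Suc a by (intro mult_left_mono) (auto simp: y_def)
    finally show ?case using le Suc by (simp add: y_def)
  qed simp
  moreover have "r n \<le> R * r n / (R - r n)" if "r n \<le> r 0"
  proof -
    have "r n * (R - r n) \<le> r n * R"
      using nonneg[of n] by (intro mult_left_mono) auto
    then show ?thesis using that r0 by (simp add: le_divide_eq mult.commute)
  qed
  ultimately show ?thesis by (meson order.trans)
qed

section \<open>Convergence\<close>

theorem theorem4p5:
  fixes E :: "real ^ 'n \<Rightarrow> real"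
    and xs :: "real ^ 'n"
    and x v vh :: "nat \<Rightarrow> real ^ 'n"
    and \<beta> :: "nat \<Rightarrow> real"
    and \<delta> M \<mu> L \<alpha> \<kappa> \<eta> rh :: real
  assumes diff: "twice_differentiable E"
    and saddle: "index1_saddle E xs"
    and delta: "\<delta> > 0"
    and x0: "x 0 \<in> ball xs \<delta>"
    and M: "M > 0"
    and lip: "\<And>y z. y \<in> ball xs \<delta> \<Longrightarrow> z \<in> ball xs \<delta> \<Longrightarrow>
                op_norm (hessian E y - hessian E z) \<le> M * norm (y - z)"
    and mu_L: "0 < \<mu>" "\<mu> < L"
    and eig_sign: "\<And>y. y \<in> ball xs \<delta> \<Longrightarrow>
                eigenvalues (hessian E y) ! 0 < 0 \<and>
                (\<forall>i. 1 \<le> i \<and> i < CARD('n) \<longrightarrow> 0 < eigenvalues (hessian E y) ! i)"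
    and eig_bound: "\<And>y i. y \<in> ball xs \<delta> \<Longrightarrow> i < CARD('n) \<Longrightarrow>
                \<bar>eigenvalues (hessian E y) ! i\<bar> \<in> {\<mu>..L}"
    and v: "\<And>n. unit_min_eigenvector (hessian E (x n)) (v n)"
    and vh: "\<And>n. norm (vh n) = 1"
    and alpha01: "\<alpha> \<in> {0..1}"
    and accuracy: "\<And>n. 1 \<ge> \<bar>v n \<bullet> vh n\<bar>\<^sup>2 \<and> \<bar>v n \<bullet> vh n\<bar>\<^sup>2 \<ge> 1 - \<alpha>"
    and kappa: "\<kappa> = L / \<mu>"
    and alpha: "0 < \<alpha>" "\<alpha> < 1/2" "1 - 2 * \<alpha> > 2 * \<kappa> * (\<alpha> + 2 * sqrt \<alpha>)"
    and eta: "\<eta> = 1 - 2 * \<alpha> - 2 * \<kappa> * (\<alpha> + 2 * sqrt \<alpha>)"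
    and rh: "rh = 2 * \<mu> * \<eta> / M"
    and r0: "norm (x 0 - xs) < min \<delta> rh"
    and beta: "\<And>n. \<beta> n = 2 / (L + (1 - 2 * \<alpha>) * \<mu>)"
    and iter: "\<And>n. x (Suc n) =
                x n - \<beta> n *\<^sub>R ((mat 1 - 2 *\<^sub>R outer (vh n) (vh n)) *v grad E (x n))"
  shows "x \<longlonglongrightarrow> xs \<and>
         (\<forall>n. norm (x n - xs) \<le>
            (1 - 2 * \<eta> / (\<kappa> + 1 - 2 * \<alpha> + 2 * \<eta>)) ^ n *
            (rh * norm (x 0 - xs) / (rh - norm (x 0 - xs))))"
proof -
  define b where "b = 2 / (L + (1 - 2 * \<alpha>) * \<mu>)"
  define \<rho> where "\<rho> = b * L - 1"
  define a where "a = b * \<mu> * \<eta>"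
  define r where "r n = norm (x n - xs)" for n
  have den: "L + (1 - 2 * \<alpha>) * \<mu> > 0" using mu_L alpha by (simp add: add_pos_pos)
  have b: "b > 0" using den by (simp add: b_def)
  have \<eta>: "\<eta> > 0" using alpha eta by simp
  have a: "a > 0" using b \<eta> mu_L by (simp add: a_def)
  \<comment> \<open>The step size is the one that equates the contraction factors at the two ends of the
    interval \<open>[(1 - 2 \<alpha>) \<mu>, L]\<close>.\<close>
  have \<rho>': "\<rho> = 1 - b * ((1 - 2 * \<alpha>) * \<mu>)"
    using den by (simp add: \<rho>_def b_def field_simps)
  have \<mu>\<rho>: "1 - b * \<mu> \<le> \<rho>"
    using b mu_L alpha by (simp add: \<rho>' algebra_simps)
  have factor: "\<rho> + 2 * b * L * sqrt \<alpha> \<le> 1 - a"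
  proof -
    have L: "L = \<mu> * \<kappa>" using mu_L kappa by simp
    have \<mu>\<eta>: "\<mu> * \<eta> = (1 - 2 * \<alpha>) * \<mu> - 2 * L * (\<alpha> + 2 * sqrt \<alpha>)"
      unfolding eta L by (simp add: algebra_simps)
    have "1 - a - (\<rho> + 2 * b * L * sqrt \<alpha>) = 2 * b * L * (\<alpha> + sqrt \<alpha>)"
      unfolding a_def \<rho>' mult.assoc \<mu>\<eta> by (simp add: algebra_simps)
    also have "\<dots> \<ge> 0" using b mu_L alpha by simp
    finally show ?thesis by simp
  qed
  have step: "r (Suc n) \<le> r n * (1 - a + a * r n / rh)" if n: "r n \<le> r 0" for n
  proof -
    let ?H = "hessian E (x n)"
    let ?d = "x n - xs"
    have r\<delta>: "r n < \<delta>" using n r0 by (simp add: r_def)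
    have seg: "xs + t *\<^sub>R ?d \<in> ball xs \<delta>" if "0 \<le> t" "t \<le> 1" for t
    proof -
      have "t * norm ?d \<le> 1 * norm ?d" using that by (intro mult_right_mono) auto
      then show ?thesis using that r\<delta> by (simp add: r_def dist_norm)
    qed
    have xn: "x n \<in> ball xs \<delta>" using seg[of 1] by simp
    have v1: "norm (v n) = 1" "?H *v v n = (eigenvalues ?H ! 0) *\<^sub>R v n"
      using v[of n] by (auto simp: unit_min_eigenvector_def)
    have zero: "grad E xs = 0" using saddle by (simp add: index1_saddle_def)
    have "norm (grad E (xs + ?d) - grad E xs - hessian E (xs + ?d) *v ?d) \<le> M / 2 * (norm ?d)\<^sup>2"
    proof (rule linearization_error_le[where g' = "\<lambda>y h. hessian E y *v h"])
      fix t :: real assume t: "0 < t" "t < 1"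
      have "xs + t *\<^sub>R ?d - x n = (t - 1) *\<^sub>R ?d" by (simp add: algebra_simps)
      then have dist: "norm (xs + t *\<^sub>R ?d - x n) = (1 - t) * norm ?d"
        using t by simp
      have "norm ((hessian E (xs + t *\<^sub>R ?d) - ?H) *v ?d)
          \<le> op_norm (hessian E (xs + t *\<^sub>R ?d) - ?H) * norm ?d"
        by (rule norm_mult_vec_le_op_norm)
      also have "\<dots> \<le> M * ((1 - t) * norm ?d) * norm ?d"
        using lip[OF seg xn, of t] t unfolding dist by (intro mult_right_mono) auto
      finally show "norm (hessian E (xs + t *\<^sub>R ?d) *v ?d - hessian E (xs + ?d) *v ?d)
          \<le> M * (1 - t) * (norm ?d)\<^sup>2"
        by (simp add: matrix_vector_mult_diff_rdistrib power2_eq_square mult_ac)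
    qed (rule hessian_has_derivative[OF diff])
    then have err: "norm (grad E (x n) - ?H *v ?d) \<le> M / 2 * (r n)\<^sup>2"
      by (simp add: zero r_def)
    have exact: "norm (?d - b *\<^sub>R reflect (v n) (?H *v ?d)) \<le> \<rho> * norm ?d"
    proof (rule exact_step_contracts[OF _ hessian_self_adjoint[OF diff] v1, where L = L and \<mu> = \<mu>])
      show "- L \<le> eigenvalues ?H ! 0" "eigenvalues ?H ! 0 \<le> - \<mu>"
        using eig_sign[OF xn] eig_bound[OF xn, of 0] by auto
    next
      fix c w assume "w \<noteq> 0" "v n \<bullet> w = 0" "?H *v w = c *\<^sub>R w"
      moreover have "v n \<noteq> 0" using v1 by auto
      ultimately obtain i where i: "1 \<le> i" "i < CARD('n)" "eigenvalues ?H ! i = c"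
        using orthogonal_eigenvalue_index[OF v1(2)] by blast
      then show "\<mu> \<le> c \<and> c \<le> L"
        using eig_sign[OF xn] eig_bound[OF xn i(2)] by auto
    qed (use b \<mu>\<rho> in \<open>auto simp: \<rho>_def\<close>)
    have bound: "norm (?H *v ?d) \<le> L * norm ?d"
    proof (rule self_adjoint_norm_le[OF _ hessian_self_adjoint[OF diff]])
      fix c w assume "w \<noteq> 0" "?H *v w = c *\<^sub>R w"
      then have "c \<in> set (eigenvalues ?H)" by (intro eigenvector_imp_eigenvalue)
      then obtain i where "i < length (eigenvalues ?H)" "eigenvalues ?H ! i = c"
        by (auto simp: in_set_conv_nth)
      then show "\<bar>c\<bar> \<le> L"
        using eig_bound[OF xn, of i] length_eigenvalues_le[of ?H] by auto
    qed simp
    have acc: "(v n \<bullet> vh n)\<^sup>2 \<ge> 1 - \<alpha>" using accuracy[of n] by simp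
    have "x (Suc n) - xs = ?d - b *\<^sub>R reflect (vh n) (grad E (x n))"
      by (simp add: iter beta outer_reflection b_def)
    then have "r (Suc n) \<le> (\<rho> + 2 * b * L * sqrt \<alpha>) * r n + b * (M / 2 * (r n)\<^sup>2)"
      using inexact_step_le[where A = "\<lambda>h. ?H *v h", OF vh v1(1) acc exact bound err b] by (simp only: r_def)
    also have "\<dots> \<le> (1 - a) * r n + b * (M / 2 * (r n)\<^sup>2)"
      using factor by (intro add_right_mono mult_right_mono) (auto simp: r_def)
    also have "b * (M / 2 * (r n)\<^sup>2) = r n * (a * r n / rh)"
      using \<eta> M mu_L by (simp add: rh a_def power2_eq_square)
    finally show ?thesis by (simp add: algebra_simps)
  qed
  have q: "1 - 2 * \<eta> / (\<kappa> + 1 - 2 * \<alpha> + 2 * \<eta>) = 1 / (1 + a)"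
  proof -
    define c where "c = \<kappa> + 1 - 2 * \<alpha>"
    have "\<kappa> > 0" using mu_L by (simp add: kappa)
    then have c: "c > 0" using alpha by (simp add: c_def)
    have "L + (1 - 2 * \<alpha>) * \<mu> = \<mu> * c" using mu_L by (simp add: c_def kappa field_simps)
    then have "a = 2 * \<eta> / c" using mu_L by (simp add: a_def b_def)
    then have "2 * \<eta> = a * c" using c by simp
    moreover have "c + a * c = c * (1 + a)" by (simp add: algebra_simps)
    ultimately have "1 - 2 * \<eta> / (c + 2 * \<eta>) = 1 - a / (1 + a)" using c by simp
    also have "\<dots> = 1 / (1 + a)" using a by (simp add: field_simps)
    finally show ?thesis by (simp add: c_def)
  qed
  have rate: "r n \<le> (1 / (1 + a)) ^ n * (rh * r 0 / (rh - r 0))" for n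
    using damped_recursion_le[of r rh a n] r0 a step by (simp add: r_def)
  have lim: "(\<lambda>n. (1 / (1 + a)) ^ n * (rh * r 0 / (rh - r 0))) \<longlonglongrightarrow> 0"
    using a by (intro tendsto_mult_left_zero LIMSEQ_realpow_zero) auto
  have "norm (r n) = r n" for n by (simp add: r_def)
  then have "\<forall>\<^sub>F n in sequentially. norm (r n) \<le> (1 / (1 + a)) ^ n * (rh * r 0 / (rh - r 0))"
    using rate by (simp only: eventually_True)
  then have "r \<longlonglongrightarrow> 0"
    using lim by (rule Lim_null_comparison)
  then have "(\<lambda>n. x n - xs) \<longlonglongrightarrow> 0"
    unfolding r_def by (rule tendsto_norm_zero_cancel)
  then have "x \<longlonglongrightarrow> xs"
    by (rule LIM_zero_cancel)
  then show ?thesis using rate unfolding q r_def by simp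
qed

end
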